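(* ($L^1$ Bonnet--Myers.) Let $(X,d,m)$ be a metric space with a random walk. Suppose that $\kappa(x,y)\geq\kappa>0$ for all distinct $x,y\in X$. Then for any distinct $x,y\in X$ one has $$d(x,y)\leq\frac{J(x)+J(y)}{\kappa(x,y)}$$ and in particular $$\mathrm{diam}\,X\leq\frac{2\sup_x J(x)}{\kappa}.$$
   Context: $(X,d)$ is a Polish metric space with its Borel $\sigma$-algebra. A random walk $m$ on $X$ is a family of probability measures $(m_x)_{x\in X}$ on $X$, depending measurably on $x$, each having finite first moment ($\int d(o,y)\,\mathrm{d}m_x(y)<\infty$ for some, hence any, $o\in X$). The $L^1$ transportation distance is $\mathcal{T}_1(\nu_1,\nu_2):=\inf_{\xi}\int_{X\times X} d(x,y)\,\mathrm{d}\xi(x,y)$, over all measures $\xi$ on $X\times X$ with marginals $\nu_1,\nu_2$. For distinct points $x,y$, the Ricci curvature in the direction $(x,y)$ is $\kappa(x,y):=1-\frac{\mathcal{T}_1(m_x,m_y)}{d(x,y)}$. The jump at $x$ is $J(x):=\int d(x,y)\,\mathrm{d}m_x(y)=\mathcal{T}_1(\delta_x,m_x)$. *)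

theory Defs
  imports "HOL-Probability.Probability"
begin

text \<open>Measurable dependence on the base point is measurability into the Giry space of
  probability measures on the Borel \<open>\<sigma>\<close>-algebra; this also forces every \<open>m x\<close> to be
  a Borel probability measure.\<close>

definition random_walk :: "('a::polish_space \<Rightarrow> 'a measure) \<Rightarrow> bool" where
  "random_walk m \<longleftrightarrow>
     m \<in> borel \<rightarrow>\<^sub>M prob_algebra borel \<and>
     (\<forall>x. \<exists>a. integrable (m x) (\<lambda>y. dist a y))"

definition couplings :: "'a::polish_space measure \<Rightarrow> 'a measure \<Rightarrow> ('a \<times> 'a) measure set" where
  "couplings \<mu> \<nu> =
     {\<xi>. sets \<xi> = sets borel \<and> distr \<xi> borel fst = \<mu> \<and> distr \<xi> borel snd = \<nu>}"

definition transport_dist :: "'a::polish_space measure \<Rightarrow> 'a measure \<Rightarrow> ennreal" where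
  "transport_dist \<mu> \<nu> = (INF \<xi>\<in>couplings \<mu> \<nu>. \<integral>\<^sup>+ p. ennreal (dist (fst p) (snd p)) \<partial>\<xi>)"

text \<open>For a random walk the transportation distance is finite (see
  \<open>transport_dist_finite\<close> below), so \<open>enn2real\<close> loses nothing here.\<close>

definition ricci_curv :: "('a::polish_space \<Rightarrow> 'a measure) \<Rightarrow> 'a \<Rightarrow> 'a \<Rightarrow> real" where
  "ricci_curv m x y = 1 - enn2real (transport_dist (m x) (m y)) / dist x y"

definition jump :: "('a::polish_space \<Rightarrow> 'a measure) \<Rightarrow> 'a \<Rightarrow> real" where
  "jump m x = (\<integral>y. dist x y \<partial>m x)"

text \<open>The library's \<open>diameter\<close> is real-valued and only meaningful on bounded sets. The
  following version takes the value \<open>\<infinity>\<close> on unbounded sets.\<close>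

definition ediameter :: "'a::metric_space set \<Rightarrow> ereal" where
  "ediameter S = (if S = {} then 0 else SUP (x, y)\<in>S \<times> S. ereal (dist x y))"

lemma ediameter_eq_diameter:
  assumes "bounded S"
  shows "ediameter S = ereal (diameter S)"
proof (cases "S = {}")
  case False
  then obtain a where a: "a \<in> S" by blast
  have "(SUP (x, y)\<in>S \<times> S. ereal (dist x y)) = ereal (diameter S)"
  proof (rule antisym)
    show "(SUP (x, y)\<in>S \<times> S. ereal (dist x y)) \<le> ereal (diameter S)"
      using assms by (auto intro!: SUP_least diameter_bounded_bound)
    show "ereal (diameter S) \<le> (SUP (x, y)\<in>S \<times> S. ereal (dist x y))" (is "_ \<le> ?R")
    proof (cases ?R)
      case (real r)
      have "dist x y \<le> r" if "x \<in> S" "y \<in> S" for x y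
      proof -
        have "ereal (dist x y) \<le> ?R"
          using that by (intro SUP_upper2[of "(x, y)"]) auto
        then show ?thesis using real by simp
      qed
      then have "diameter S \<le> r"
        using False unfolding diameter_def by (auto intro!: cSUP_least)
      then show ?thesis using real by simp
    next
      case MInf
      have "ereal (dist a a) \<le> ?R"
        using a by (intro SUP_upper2[of "(a, a)"]) auto
      then show ?thesis using MInf by simp
    qed simp
  qed
  then show ?thesis using False by (simp add: ediameter_def)
qed (simp add: ediameter_def diameter_def)

lemma random_walk_prob:
  assumes "random_walk m"
  shows "prob_space (m x)" and "sets (m x) = sets borel"
proof -
  have "m x \<in> space (prob_algebra borel)"
    using assms by (auto simp: random_walk_def intro: measurable_space[of m borel])
  then show "prob_space (m x)" "sets (m x) = sets borel"
    by (auto simp: space_prob_algebra)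
qed

lemma random_walk_integrable_dist:
  assumes "random_walk m"
  shows "integrable (m x) (\<lambda>y. dist b y)"
proof -
  interpret prob_space "m x" using assms by (rule random_walk_prob)
  note [measurable_cong] = random_walk_prob(2)[OF assms, of x]
  obtain a where a: "integrable (m x) (\<lambda>y. dist a y)"
    using assms unfolding random_walk_def by blast
  show ?thesis
  proof (rule Bochner_Integration.integrable_bound)
    show "integrable (m x) (\<lambda>y. dist b a + dist a y)" using a by simp
  qed (auto intro: dist_triangle)
qed

lemma pair_measure_in_couplings:
  assumes "prob_space \<mu>" "prob_space \<nu>" "sets \<mu> = sets borel" "sets \<nu> = sets borel"
  shows "\<mu> \<Otimes>\<^sub>M \<nu> \<in> couplings \<mu> \<nu>"
proof -
  interpret P: pair_prob_space \<mu> \<nu>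
    using assms by (simp add: pair_prob_space_def pair_sigma_finite_def prob_space_imp_sigma_finite)
  have 1: "sets (\<mu> \<Otimes>\<^sub>M \<nu>) = sets borel"
    using assms(3,4) by (simp add: borel_prod[symmetric] cong: sets_pair_measure_cong)
  have "distr (\<mu> \<Otimes>\<^sub>M \<nu>) borel fst = distr (\<mu> \<Otimes>\<^sub>M \<nu>) \<mu> fst"
    using assms(3) by (intro distr_cong) auto
  moreover have "distr (\<mu> \<Otimes>\<^sub>M \<nu>) borel snd = distr (\<mu> \<Otimes>\<^sub>M \<nu>) \<nu> snd"
    using assms(4) by (intro distr_cong) auto
  moreover have "distr (\<mu> \<Otimes>\<^sub>M \<nu>) \<nu> snd = \<nu>"
  proof (rule measure_eqI)
    fix A assume "A \<in> sets (distr (\<mu> \<Otimes>\<^sub>M \<nu>) \<nu> snd)"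
    then have A: "A \<in> sets \<nu>" by simp
    then have "snd -` A \<inter> space (\<mu> \<Otimes>\<^sub>M \<nu>) = space \<mu> \<times> A"
      by (auto simp: space_pair_measure dest: sets.sets_into_space)
    with A show "emeasure (distr (\<mu> \<Otimes>\<^sub>M \<nu>) \<nu> snd) A = emeasure \<nu> A"
      by (simp add: emeasure_distr P.M2.emeasure_pair_measure_Times P.M1.emeasure_space_1)
  qed simp
  ultimately show ?thesis
    using 1 by (simp add: couplings_def P.M2.distr_pair_fst)
qed

lemma transport_dist_finite:
  assumes "random_walk m"
  shows "transport_dist (m x) (m y) < \<infinity>"
proof -
  interpret P: pair_prob_space "m x" "m y"
    using random_walk_prob(1)[OF assms]
    by (simp add: pair_prob_space_def pair_sigma_finite_def prob_space_imp_sigma_finite)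
  note [measurable_cong] = random_walk_prob(2)[OF assms]
  have fin: "(\<integral>\<^sup>+ z. ennreal (dist x z) \<partial>m w) < \<infinity>" for w
    using random_walk_integrable_dist[OF assms, of w x] by (simp add: integrable_iff_bounded)
  have "transport_dist (m x) (m y) \<le> (\<integral>\<^sup>+ p. ennreal (dist (fst p) (snd p)) \<partial>(m x \<Otimes>\<^sub>M m y))"
    unfolding transport_dist_def
    by (intro INF_lower pair_measure_in_couplings random_walk_prob[OF assms])
  also have "\<dots> \<le> (\<integral>\<^sup>+ p. ennreal (dist x (fst p)) + ennreal (dist x (snd p)) \<partial>(m x \<Otimes>\<^sub>M m y))"
    by (intro nn_integral_mono)
      (simp add: ennreal_plus[symmetric] dist_triangle3 del: ennreal_plus)
  also have "\<dots> = (\<integral>\<^sup>+ u. \<integral>\<^sup>+ v. ennreal (dist x u) + ennreal (dist x v) \<partial>m y \<partial>m x)"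
    by (subst P.M2.nn_integral_fst[symmetric]) auto
  also have "\<dots> = (\<integral>\<^sup>+ u. ennreal (dist x u) \<partial>m x) + (\<integral>\<^sup>+ v. ennreal (dist x v) \<partial>m y)"
    by (simp add: nn_integral_add P.M1.emeasure_space_1 P.M2.emeasure_space_1)
  also have "\<dots> < \<infinity>" using fin by simp
  finally show ?thesis .
qed

end

theory Submission
  imports Defs
begin

text \<open>The triangle inequality for the transportation distance along
  \<open>\<delta>\<^sub>x\<close>, \<open>m x\<close>, \<open>m y\<close>, \<open>\<delta>\<^sub>y\<close> gives \<open>d(x,y) \<le> J(x) + (1 - \<kappa>(x,y)) d(x,y) + J(y)\<close>.
  Since Dirac masses are at the ends, it suffices to integrate
  \<open>d(x,y) \<le> d(x,u) + d(u,v) + d(v,y)\<close> against each coupling of \<open>m x\<close> and \<open>m y\<close>.\<close>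

lemma jump_nonneg: "0 \<le> jump m x"
  by (simp add: jump_def)

text \<open>The finite first moment matters: without integrability the Bochner integral in
  \<open>jump\<close> would default to 0.\<close>

lemma nn_integral_dist_eq_jump:
  assumes "random_walk m"
  shows "(\<integral>\<^sup>+ y. ennreal (dist x y) \<partial>m x) = ennreal (jump m x)"
  unfolding jump_def using random_walk_integrable_dist[OF assms]
  by (intro nn_integral_eq_integral) auto

lemma dist_le_jump_plus_transport_dist:
  assumes "random_walk m"
  shows "ennreal (dist x y) \<le> ennreal (jump m x) + transport_dist (m x) (m y) + ennreal (jump m y)"
proof -
  have bound: "ennreal (dist x y)
      \<le> (ennreal (jump m x) + ennreal (jump m y)) + (\<integral>\<^sup>+ p. ennreal (dist (fst p) (snd p)) \<partial>\<xi>)"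
    if "\<xi> \<in> couplings (m x) (m y)" for \<xi>
  proof -
    have sets: "sets \<xi> = sets borel"
      and fst: "distr \<xi> borel fst = m x" and snd: "distr \<xi> borel snd = m y"
      using that by (auto simp: couplings_def)
    \<comment> \<open>A Polish space is second countable, so the Borel sets of the square form the
      product \<sigma>-algebra, for which the projections are measurable.\<close>
    have [measurable_cong]: "sets \<xi> = sets (borel \<Otimes>\<^sub>M borel)"
      unfolding borel_prod by (rule sets)
    \<comment> \<open>\<open>couplings\<close> does not ask for total mass 1; it is inherited from
      the first marginal.\<close>
    interpret prob_space \<xi>
    proof (rule prob_space_distrD)
      show "fst \<in> \<xi> \<rightarrow>\<^sub>M borel" by measurable
      show "prob_space (distr \<xi> borel fst)"
        unfolding fst by (rule random_walk_prob(1)[OF assms])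
    qed
    \<comment> \<open>Each outer distance depends on one coordinate only, so its integral is
      determined by a marginal and is the same for every coupling.\<close>
    have "(\<integral>\<^sup>+ p. ennreal (dist x (fst p)) \<partial>\<xi>) = (\<integral>\<^sup>+ u. ennreal (dist x u) \<partial>distr \<xi> borel fst)"
      by (rule nn_integral_distr[symmetric]) measurable
    then have J1: "(\<integral>\<^sup>+ p. ennreal (dist x (fst p)) \<partial>\<xi>) = ennreal (jump m x)"
      by (simp only: fst nn_integral_dist_eq_jump[OF assms])
    have "(\<integral>\<^sup>+ p. ennreal (dist y (snd p)) \<partial>\<xi>) = (\<integral>\<^sup>+ u. ennreal (dist y u) \<partial>distr \<xi> borel snd)"
      by (rule nn_integral_distr[symmetric]) measurable
    then have J2: "(\<integral>\<^sup>+ p. ennreal (dist y (snd p)) \<partial>\<xi>) = ennreal (jump m y)"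
      by (simp only: snd nn_integral_dist_eq_jump[OF assms])
    have "ennreal (dist x y) = (\<integral>\<^sup>+ p. ennreal (dist x y) \<partial>\<xi>)"
      by (simp add: emeasure_space_1)
    also have "\<dots> \<le> (\<integral>\<^sup>+ p. (ennreal (dist x (fst p)) + ennreal (dist y (snd p)))
                              + ennreal (dist (fst p) (snd p)) \<partial>\<xi>)"
    proof (intro nn_integral_mono)
      fix p :: "'a \<times> 'a"
      have "dist x y \<le> dist x (fst p) + dist y (snd p) + dist (fst p) (snd p)"
        using dist_triangle[of x y "fst p"] dist_triangle[of "fst p" y "snd p"]
        by (simp add: dist_commute)
      then show "ennreal (dist x y) \<le> (ennreal (dist x (fst p)) + ennreal (dist y (snd p)))
                              + ennreal (dist (fst p) (snd p))"
        by (simp add: ennreal_plus[symmetric] del: ennreal_plus)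
    qed
    also have "\<dots> = (ennreal (jump m x) + ennreal (jump m y))
                      + (\<integral>\<^sup>+ p. ennreal (dist (fst p) (snd p)) \<partial>\<xi>)"
      by (simp add: nn_integral_add J1 J2)
    finally show ?thesis .
  qed
  \<comment> \<open>Truncated subtraction isolates the integral over the coupling, so that the
    infimum can be taken; finiteness of the terms on the left allows the way back.\<close>
  have "ennreal (dist x y) - (ennreal (jump m x) + ennreal (jump m y)) \<le> transport_dist (m x) (m y)"
    unfolding transport_dist_def using bound
    by (intro INF_greatest) (simp add: ennreal_minus_le_iff)
  then have "ennreal (dist x y)
      \<le> (ennreal (jump m x) + ennreal (jump m y)) + transport_dist (m x) (m y)"
    by (simp add: ennreal_minus_le_iff)
  then show ?thesis by (simp add: ac_simps)
qed

text \<open>The left side is distance minus transport cost. In this product form the sign of the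
  curvature is irrelevant. Finite cost is essential, since \<open>enn2real\<close> sends infinity to
  0.\<close>

lemma dist_times_ricci_curv_le:
  assumes "random_walk m" "x \<noteq> y"
  shows "dist x y * ricci_curv m x y \<le> jump m x + jump m y"
proof -
  define t where "t = enn2real (transport_dist (m x) (m y))"
  have t: "transport_dist (m x) (m y) = ennreal t" "0 \<le> t"
    using transport_dist_finite[OF assms(1), of x y] by (auto simp: t_def)
  have "dist x y \<le> jump m x + t + jump m y"
    using dist_le_jump_plus_transport_dist[OF assms(1), of x y] t(2)
    by (simp add: t(1) jump_nonneg ennreal_plus[symmetric] del: ennreal_plus)
  then show ?thesis
    using assms(2) by (simp add: ricci_curv_def t_def[symmetric] right_diff_distrib)
qed

theorem proposition23:
  fixes m :: "'a::polish_space \<Rightarrow> 'a measure" and \<kappa> :: real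
  assumes "random_walk m"
    and "\<kappa> > 0"
    and "\<And>x y. x \<noteq> y \<Longrightarrow> ricci_curv m x y \<ge> \<kappa>"
  shows "(\<forall>x y. x \<noteq> y \<longrightarrow> dist x y \<le> (jump m x + jump m y) / ricci_curv m x y) \<and>
         ediameter (UNIV :: 'a set) \<le> 2 * (SUP x. ereal (jump m x)) / ereal \<kappa>"
proof (intro conjI allI impI)
  fix x y :: 'a
  assume "x \<noteq> y"
  then show "dist x y \<le> (jump m x + jump m y) / ricci_curv m x y"
    using dist_times_ricci_curv_le[OF assms(1)] assms(2) assms(3)[of x y]
    by (simp add: pos_le_divide_eq)
next
  let ?S = "SUP x. ereal (jump m x)"
  have "ereal (dist x y) \<le> 2 * ?S / ereal \<kappa>" for x y :: 'a
  proof -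
    have "dist x y * \<kappa> \<le> jump m x + jump m y"
    \<comment> \<open>The supremum defining the diameter includes the diagonal, where the curvature
      hypothesis is silent.\<close>
    proof (cases "x = y")
      case False
      then have "dist x y * \<kappa> \<le> dist x y * ricci_curv m x y"
        using assms(3) by (intro mult_left_mono) auto
      with dist_times_ricci_curv_le[OF assms(1) False] show ?thesis by linarith
    qed (simp add: jump_nonneg)
    then have "ereal \<kappa> * ereal (dist x y) \<le> ereal (jump m x) + ereal (jump m y)"
      by (simp add: mult.commute)
    also have "\<dots> \<le> ?S + ?S"
      by (intro add_mono SUP_upper) auto
    \<comment> \<open>The jumps may be unbounded, so \<open>?S\<close> can be infinite.\<close>
    also have "\<dots> = 2 * ?S"
      by (cases ?S) auto
    finally show ?thesis
      using assms(2) by (simp add: ereal_le_divide_pos)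
  qed
  then show "ediameter (UNIV :: 'a set) \<le> 2 * ?S / ereal \<kappa>"
    by (auto simp: ediameter_def intro!: SUP_least)
qed

end
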